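(* Let $n\ge1$ and let $\rho\in L^1(\mathbb{R}^n)$ be a non-negative, rotationally symmetric kernel that is non-increasing in $|r|$ and decays to zero at infinity. Suppose $u:\mathbb{R}^n\times[0,\infty)\to\mathbb{R}$ is a smooth solution of the non-linear non-local heat equation $$u_t(x,t)=L_{\mathbb{R}^n}u(x,t)+q(|Du(x,t)|),\quad x\in\mathbb{R}^n,\ t\in(0,\infty),\qquad u(x,0)=u_0(x),\quad x\in\mathbb{R}^n,$$ with $\|u(\cdot,t)\|_{L^\infty(\mathbb{R}^n)}\le1$ for all $t\ge0$. The non-linear term $q(p)$, $p\ge0$, satisfies: (i) $q(p)$ is non-decreasing and $q(0)=0$; and (ii) $q$ is at least $C^1$ and satisfies $\left|\frac{dq(p)}{dp}\right|\le c$ for some constant $c>0$. Let $\varphi:[0,\infty)\times[0,\infty)\to[0,\infty)$ be a function with the following properties. (a) $\varphi'(r,t):=\partial_r\varphi(r,t)>0$ for $r>0$, and $\lim_{r\to0^+}\varphi(r,t)=\varphi(0,t)=0$ for each $t\ge0$. (b) $\varphi(\cdot,0)$ is a modulus of continuity for $u(\cdot,0)$. (c) The odd extension $\tilde\varphi(r,t)=\varphi(r,t)$ for $r\ge0$, $\tilde\varphi(r,t)=-\varphi(-r,t)$ for $r<0$, is a (classical) solution of the one-dimensional non-local heat equation $$\tilde\varphi_t(r,t)=\tilde L\tilde\varphi(r,t),\qquad r\in\mathbb{R},\ t>0.$$ Assume furthermore: (d) There exists a smooth, radially symmetric function $\Psi:\mathbb{R}^n\to[1,\infty)$ such that $\Psi(x)\to\infty$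 as $|x|\to\infty$, satisfying $$0\le K:=\sup_{x\in\mathbb{R}^n}L_{\mathbb{R}^n}\Psi(x)<\infty\qquad\text{and}\qquad K_\nabla:=\sup_{x\in\mathbb{R}^n}\frac{|D\Psi(x)|}{\Psi(x)}<\infty.$$ Then for every $t\ge0$, $\varphi(\cdot,t)$ is a modulus of continuity for $u(\cdot,t)$ on $\mathbb{R}^n$, i.e. $$|u(y,t)-u(x,t)|\le2\varphi\left(\frac{|x-y|}{2},t\right)\qquad\text{for all }x,y\in\mathbb{R}^n,\ t\ge0.$$
   Context: The non-local operator is $L_{\mathbb{R}^n}u(x):=\int_{\mathbb{R}^n}\rho(z-x)(u(z)-u(x))\,dz$ (acting in the space variable). Its one-dimensional reduction is $$\tilde Lv(r):=\int_{\mathbb{R}}\tilde\rho(w)\bigl(v(r+w)-v(r)\bigr)\,dw,\qquad\tilde\rho(w)=\int_{\mathbb{R}^{n-1}}\rho(w,p)\,dp$$ (with $\tilde\rho=\rho$ when $n=1$). $D$ denotes the gradient in the space variable. A function $\omega:[0,\infty)\to[0,\infty)$ is a modulus of continuity for $f:\mathbb{R}^n\to\mathbb{R}$ if $\omega$ is continuous at zero, $\omega(0)=0$, and $|f(y)-f(x)|\le2\omega\left(\frac{|y-x|}{2}\right)$ for all $x,y\in\mathbb{R}^n$. "Smooth (classical) solution" is understood as follows: $u$ is smooth on $\mathbb{R}^n\times(0,\infty)$ and jointly continuous on $\mathbb{R}^n\times[0,\infty)$; $\varphi$ is jointly continuous on $[0,\infty)\times[0,\infty)$ and $\tilde\varphi_t$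 exists for $t>0$; the integrals defining $L_{\mathbb{R}^n}u$, $L_{\mathbb{R}^n}\Psi$ and $\tilde L\tilde\varphi$ converge absolutely; and the equations hold pointwise. *)

theory Defs
  imports "HOL-Analysis.Analysis" "HOL-Probability.Essential_Supremum"
begin

text \<open>
  \<open>smooth_on S f\<close> means that \<open>f\<close> is C-infinity on \<open>S\<close>. It is only meant for open \<open>S\<close>: derivatives
  are taken in the whole space. The case \<open>Suc k\<close> asks for a Frechet derivative at every point
  of \<open>S\<close>, all of whose directional components are C-k.
\<close>

primrec Ck_on :: "'a::real_normed_vector set \<Rightarrow> ('a \<Rightarrow> real) \<Rightarrow> nat \<Rightarrow> bool" where
  "Ck_on S f 0 \<longleftrightarrow> continuous_on S f"
| "Ck_on S f (Suc k) \<longleftrightarrow>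
     (\<forall>x\<in>S. f differentiable (at x)) \<and>
     (\<forall>v. Ck_on S (\<lambda>x. frechet_derivative f (at x) v) k)"

definition smooth_on :: "'a::real_normed_vector set \<Rightarrow> ('a \<Rightarrow> real) \<Rightarrow> bool" where
  "smooth_on S f \<longleftrightarrow> (\<forall>k. Ck_on S f k)"

definition grad :: "('a::real_inner \<Rightarrow> real) \<Rightarrow> 'a \<Rightarrow> 'a" where
  "grad f x = (THE D. GDERIV f x :> D)"

definition nonlocal_integrand :: "('a::euclidean_space \<Rightarrow> real) \<Rightarrow> ('a \<Rightarrow> real) \<Rightarrow> 'a \<Rightarrow> 'a \<Rightarrow> real" where
  "nonlocal_integrand \<rho> u x z = \<rho> (z - x) * (u z - u x)"

definition nonlocal_op :: "('a::euclidean_space \<Rightarrow> real) \<Rightarrow> ('a \<Rightarrow> real) \<Rightarrow> 'a \<Rightarrow> real" where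
  "nonlocal_op \<rho> u x = (\<integral>z. nonlocal_integrand \<rho> u x z \<partial>lborel)"

text \<open>
  The reduced kernel integrates out all coordinates except the \<open>k\<close>-th. The space of the remaining
  \<open>CARD('n) - 1\<close> coordinates is the product measure over the index set \<open>UNIV - {k}\<close>, which is a
  one-point probability space if \<open>CARD('n) = 1\<close>; see \<open>reduced_kernel_dim_1\<close>. For a radial
  kernel the choice of \<open>k\<close> is immaterial.
\<close>

definition reduced_kernel :: "'n \<Rightarrow> (real ^ 'n::finite \<Rightarrow> real) \<Rightarrow> real \<Rightarrow> real" where
  "reduced_kernel k \<rho> w =
     (\<integral>p. \<rho> (\<chi> i. if i = k then w else p i) \<partial>(\<Pi>\<^sub>M i\<in>UNIV - {k}. (lborel :: real measure)))"

lemma reduced_kernel_dim_1: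
  fixes \<rho> :: "real ^ 'n::finite \<Rightarrow> real"
  assumes "CARD('n) = 1"
  shows "reduced_kernel k \<rho> w = \<rho> (vec w)"
proof -
  have U: "(UNIV :: 'n set) = {k}"
    using assms by (metis UNIV_I card_1_singletonE singletonD)
  then have all_k: "i = k" for i :: 'n
    by blast
  have "(\<chi> i. if i = k then w else p i) = (vec w :: real ^ 'n)" for p
    using all_k by (simp add: vec_eq_iff)
  moreover have E: "(UNIV :: 'n set) - {k} = {}"
    using U by blast
  ultimately show ?thesis
    unfolding reduced_kernel_def E PiM_empty
    by (simp add: lebesgue_integral_count_space_finite)
qed

definition nonlocal1_integrand :: "(real \<Rightarrow> real) \<Rightarrow> (real \<Rightarrow> real) \<Rightarrow> real \<Rightarrow> real \<Rightarrow> real" where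
  "nonlocal1_integrand \<rho>' v r w = \<rho>' w * (v (r + w) - v r)"

definition nonlocal1_op :: "(real \<Rightarrow> real) \<Rightarrow> (real \<Rightarrow> real) \<Rightarrow> real \<Rightarrow> real" where
  "nonlocal1_op \<rho>' v r = (\<integral>w. nonlocal1_integrand \<rho>' v r w \<partial>lborel)"

text \<open>
  Functions on \<open>[0,\<infinity>)\<close> are represented by functions on the reals whose values at negative
  arguments are irrelevant.
\<close>

definition odd_ext :: "(real \<Rightarrow> real) \<Rightarrow> real \<Rightarrow> real" where
  "odd_ext v r = (if r \<ge> 0 then v r else - v (- r))"

definition modulus_of_continuity :: "(real \<Rightarrow> real) \<Rightarrow> ('a::real_normed_vector \<Rightarrow> real) \<Rightarrow> bool" where
  "modulus_of_continuity \<omega> f \<longleftrightarrow>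
     (\<forall>s\<ge>0. \<omega> s \<ge> 0) \<and>
     continuous (at 0 within {0..}) \<omega> \<and>
     \<omega> 0 = 0 \<and>
     (\<forall>x y. \<bar>f y - f x\<bar> \<le> 2 * \<omega> (norm (y - x) / 2))"

end

theory Submission
  imports Defs
begin

text \<open>
  The proof is a maximum principle for a function of two points. For \<open>\<epsilon> > 0\<close> consider
  \<open>Z = u(y,t) - u(x,t) - 2 \<phi>(\<bar>y - x\<bar>/2, t) - \<epsilon> e\<^bsup>Ct\<^esup> (\<Psi>(x) + \<Psi>(y))\<close>.
  Initially \<open>Z < 0\<close>. If \<open>Z\<close> ever becomes non-negative, then, as \<open>u\<close> is bounded and \<open>\<Psi>\<close> tends to infinity,
  there is a first time \<open>t\<close> and a pair \<open>x \<noteq> y\<close> at which \<open>Z\<close> vanishes and attains its maximum over all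
  pairs (\<open>first_touching_time\<close>). There \<open>\<partial>\<^sub>t Z \<ge> 0\<close>, and each term of \<open>\<partial>\<^sub>t Z\<close> can be estimated.

  The spatial derivatives of \<open>Z\<close> vanish, so \<open>Du(x)\<close> and \<open>Du(y)\<close> are equal up to terms of the form
  \<open>\<epsilon> D\<Psi>\<close> (\<open>grad_at_touching_point\<close>); since \<open>q\<close> is Lipschitz with constant \<open>c\<close> and \<open>\<bar>D\<Psi>\<bar> \<le> K\<^sub>\<nabla> \<Psi>\<close>, the two
  nonlinear terms differ by at most \<open>c K\<^sub>\<nabla> \<epsilon> e\<^bsup>Ct\<^esup> (\<Psi>(x) + \<Psi>(y))\<close>.

  The heart of the matter is the non-local term (\<open>nonlocal_op_reflection_coupling\<close>). Pairing each jump
  from \<open>y\<close> with its mirror image in the bisector of \<open>x\<close> and \<open>y\<close>, and using that \<open>\<rho>\<close> favours short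
  jumps, gives
  \<open>Lu(y) - Lu(x) \<le> 2 \<integral> \<rho>(v) (\<phi>(r + v \<bullet> e) - \<phi>(r)) dv + \<epsilon> e\<^bsup>Ct\<^esup> (L\<Psi>(x) + L\<Psi>(y))\<close>,
  where \<open>r = \<bar>y - x\<bar>/2\<close>, \<open>e\<close> is the direction of \<open>y - x\<close> and \<open>\<phi>\<close> is extended as an odd function. Lebesgue
  measure and \<open>\<rho>\<close> are rotation invariant, so the integral is the one-dimensional operator with the
  reduced kernel (\<open>radial_integral_direction\<close>), that is, \<open>\<partial>\<^sub>t \<phi>(r,t)\<close>. With \<open>L\<Psi> \<le> K \<le> K \<Psi>\<close> everything
  adds up to \<open>C \<le> K + c K\<^sub>\<nabla>\<close>, which fails for \<open>C = K + c K\<^sub>\<nabla> + 1\<close>. Hence \<open>Z < 0\<close> for every \<open>\<epsilon>\<close>, and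
  \<open>\<epsilon> \<rightarrow> 0\<close> is the claim.
\<close>

section \<open>Reflections\<close>

text \<open>
  The reflection in the hyperplane orthogonal to \<open>d\<close>. Division by zero makes it the identity when
  \<open>d = 0\<close>, so that \<open>reflection (a - b)\<close> exchanges two vectors of equal norm even if they coincide.
\<close>

definition reflection :: "'a::real_inner \<Rightarrow> 'a \<Rightarrow> 'a" where
  "reflection d v = v - (2 * (v \<bullet> d) / (d \<bullet> d)) *\<^sub>R d"

lemma linear_reflection: "linear (reflection d)"
  by (rule linearI) (simp_all add: reflection_def inner_add_left add_divide_distrib distrib_left scaleR_add_left scaleR_diff_right)

lemma inner_reflection: "reflection d v \<bullet> reflection d w = v \<bullet> w"
  by (cases "d = 0")
     (auto simp: reflection_def inner_diff_left inner_diff_right inner_commute[of d w] field_simps)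

lemma norm_reflection: "norm (reflection d v) = norm v"
  by (simp add: norm_eq_sqrt_inner inner_reflection)

lemma reflection_reflection [simp]: "reflection d (reflection d v) = v"
proof -
  have "reflection d v \<bullet> d = - (v \<bullet> d)"
    by (cases "d = 0") (simp_all add: reflection_def inner_diff_left)
  then show ?thesis
    unfolding reflection_def[of d "reflection d v"] by (simp add: reflection_def)
qed

lemma reflection_swap:
  assumes "norm a = norm b" shows "reflection (a - b) a = b"
proof (cases "a = b")
  case False
  have "(a - b) \<bullet> (a - b) = 2 * (a \<bullet> (a - b))"
    using assms by (simp add: norm_eq inner_diff_left inner_diff_right inner_commute)
  moreover have "(a - b) \<bullet> (a - b) \<noteq> 0"
    using False by simp
  ultimately have "2 * (a \<bullet> (a - b)) / ((a - b) \<bullet> (a - b)) = 1"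
    by (metis divide_self)
  then show ?thesis
    unfolding reflection_def by (simp only: scaleR_one) simp
qed (simp add: reflection_def)

lemma borel_measurable_reflection [measurable]:
  "reflection (d :: 'a::euclidean_space) \<in> borel_measurable borel"
  unfolding reflection_def by measurable

section \<open>Invariance of Lebesgue measure under linear isometries\<close>

lemma nn_integral_lborel_translate:
  fixes c :: "'a::euclidean_space"
  assumes [measurable]: "f \<in> borel_measurable borel"
  shows "(\<integral>\<^sup>+x. f (c + x) \<partial>lborel) = (\<integral>\<^sup>+x. f x \<partial>lborel)"
proof -
  have "(\<integral>\<^sup>+x. f x \<partial>lborel) = (\<integral>\<^sup>+x. f x \<partial>(distr lborel borel ((+) c)))"
    by (simp add: lborel_distr_plus)
  also have "\<dots> = (\<integral>\<^sup>+x. f (c + x) \<partial>lborel)"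
    by (subst nn_integral_distr) auto
  finally show ?thesis by simp
qed

lemma nn_integral_lborel_point_reflect:
  fixes c :: "'a::euclidean_space"
  assumes [measurable]: "f \<in> borel_measurable borel"
  shows "(\<integral>\<^sup>+x. f (c - x) \<partial>lborel) = (\<integral>\<^sup>+x. f x \<partial>lborel)"
proof -
  have "lborel = distr lborel borel (\<lambda>x::'a. c + (-1) *\<^sub>R x)"
    by (subst lborel_affine[of "-1" c]) (simp_all add: density_1)
  then have "(\<integral>\<^sup>+x. f x \<partial>lborel) = (\<integral>\<^sup>+x. f x \<partial>(distr lborel borel (\<lambda>x::'a. c - x)))"
    by simp
  also have "\<dots> = (\<integral>\<^sup>+x. f (c - x) \<partial>lborel)"
    by (subst nn_integral_distr) auto
  finally show ?thesis by simp
qed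

text \<open>
  This is the uniqueness of translation-invariant measures. The image measure \<open>\<mu>\<close> of Lebesgue
  measure under \<open>T\<close> is invariant under translations because \<open>T\<close> is linear and onto. For two such
  measures, shifting the variables of \<open>\<integral>\<integral> 1\<^sub>A(x) 1\<^sub>B(y) d\<mu> dy\<close> one after the other exchanges the two sets
  \<open>A\<close> and \<open>B\<close>, so the measures are proportional. The unit ball, which \<open>T\<close> preserves, shows that the
  factor is 1.
\<close>

lemma lborel_distr_linear_isometry:
  fixes T :: "'a::euclidean_space \<Rightarrow> 'a"
  assumes lin: "linear T" and iso: "\<And>x. norm (T x) = norm x"
  shows "distr lborel borel T = lborel"
proof (rule measure_eqI)
  have [measurable]: "T \<in> borel_measurable borel"
    using lin by (intro borel_measurable_continuous_onI linear_continuous_on) (simp add: linear_conv_bounded_linear)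
  have "inj T"
    using iso by (subst linear_injective_0[OF lin]) (metis norm_eq_zero)
  then obtain S where S: "\<And>y. T (S y) = y"
    using linear_injective_imp_surjective[OF lin] by (metis surj_f_inv_f)
  define \<mu> where "\<mu> A = (\<integral>\<^sup>+x. indicator A (T x) \<partial>lborel)" for A
  have \<mu>: "emeasure (distr lborel borel T) A = \<mu> A" if [measurable]: "A \<in> sets borel" for A
    unfolding \<mu>_def by (subst nn_integral_distr[symmetric]) (auto simp: nn_integral_indicator[symmetric] simp del: nn_integral_indicator)
  have exch: "\<mu> A * emeasure lborel B = \<mu> B * emeasure lborel A"
    if [measurable]: "A \<in> sets borel" "B \<in> sets borel" for A B
  proof -
    have "\<mu> A * emeasure lborel B = (\<integral>\<^sup>+x. indicator A (T x) * emeasure lborel B \<partial>lborel)"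
      unfolding \<mu>_def by (subst nn_integral_multc) auto
    also have "\<dots> = (\<integral>\<^sup>+x. indicator A (T x) * (\<integral>\<^sup>+y. indicator B (T x + y) \<partial>lborel) \<partial>lborel)"
      by (subst nn_integral_lborel_translate) auto
    also have "\<dots> = (\<integral>\<^sup>+x. (\<integral>\<^sup>+y. indicator A (T x) * indicator B (T x + y) \<partial>lborel) \<partial>lborel)"
      by (rule nn_integral_cong, rule nn_integral_cmult[symmetric]) auto
    also have "\<dots> = (\<integral>\<^sup>+y. (\<integral>\<^sup>+x. indicator A (T x) * indicator B (T x + y) \<partial>lborel) \<partial>lborel)"
      by (rule lborel_pair.Fubini') (measurable)
    also have "\<dots> = (\<integral>\<^sup>+y. (\<integral>\<^sup>+x. indicator A (T x - y) * indicator B (T x) \<partial>lborel) \<partial>lborel)"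
    proof (rule nn_integral_cong)
      fix y :: 'a
      have T: "T (x - S y) = T x - y" for x
        by (simp add: linear_diff[OF lin] S)
      show "(\<integral>\<^sup>+x. indicator A (T x) * indicator B (T x + y) \<partial>lborel)
          = (\<integral>\<^sup>+x. indicator A (T x - y) * indicator B (T x) \<partial>lborel)"
        using nn_integral_lborel_translate[where c="- S y" and f="\<lambda>x. indicator A (T x) * indicator B (T x + y)"]
        by (simp add: T)
    qed
    also have "\<dots> = (\<integral>\<^sup>+x. (\<integral>\<^sup>+y. indicator B (T x) * indicator A (T x - y) \<partial>lborel) \<partial>lborel)"
      by (subst lborel_pair.Fubini') (measurable, simp add: mult.commute)
    also have "\<dots> = (\<integral>\<^sup>+x. indicator B (T x) * (\<integral>\<^sup>+y. indicator A (T x - y) \<partial>lborel) \<partial>lborel)"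
      by (rule nn_integral_cong, rule nn_integral_cmult) auto
    also have "\<dots> = (\<integral>\<^sup>+x. indicator B (T x) * emeasure lborel A \<partial>lborel)"
      by (subst nn_integral_lborel_point_reflect) auto
    also have "\<dots> = \<mu> B * emeasure lborel A"
      unfolding \<mu>_def by (subst nn_integral_multc) auto
    finally show ?thesis .
  qed
  let ?B = "ball (0::'a) 1"
  have \<mu>B: "\<mu> ?B = emeasure lborel ?B"
  proof -
    have "\<mu> ?B = (\<integral>\<^sup>+x. indicator ?B x \<partial>lborel)"
      unfolding \<mu>_def by (intro nn_integral_cong) (auto simp: indicator_def iso)
    then show ?thesis by simp
  qed
  have fin: "emeasure lborel ?B \<noteq> \<infinity>"
    using emeasure_bounded_finite[of ?B] by auto
  have pos: "emeasure lborel ?B \<noteq> 0"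
  proof
    assume "emeasure lborel ?B = 0"
    then have "negligible ?B"
      by (simp add: negligible_iff_null_sets null_setsI null_sets_completionI)
    then show False using open_not_negligible[of ?B] by simp
  qed
  fix A assume "A \<in> sets (distr lborel borel T)"
  then have [measurable]: "A \<in> sets borel" by simp
  have "emeasure lborel ?B * \<mu> A = emeasure lborel ?B * emeasure lborel A"
    using exch[of A ?B] \<mu>B by (simp add: mult.commute)
  then show "emeasure (distr lborel borel T) A = emeasure lborel A"
    using fin pos by (simp add: \<mu> ennreal_mult_cancel_left)
qed simp

lemma lborel_distr_reflection: "distr lborel borel (reflection d) = (lborel :: 'a::euclidean_space measure)"
  by (rule lborel_distr_linear_isometry) (simp_all add: linear_reflection norm_reflection)

section \<open>The reduced kernel as a marginal density\<close>

lemma distr_PiM_lborel_vec: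
  "distr (Pi\<^sub>M UNIV (\<lambda>_::'n::finite. lborel :: real measure)) borel (\<lambda>f. \<chi> i. f i) = lborel"
proof (rule lborel_eqI[symmetric])
  interpret product_sigma_finite "\<lambda>_::'n. lborel :: real measure" by standard
  let ?M = "Pi\<^sub>M UNIV (\<lambda>_::'n. lborel :: real measure)"
  have [measurable]: "(\<lambda>f. \<chi> i. f i) \<in> ?M \<rightarrow>\<^sub>M (borel :: (real^'n) measure)"
    by (subst borel_measurable_euclidean_space) (auto simp: Basis_vec_def inner_axis)
  fix l u :: "real^'n" assume le: "\<And>b. b \<in> Basis \<Longrightarrow> l \<bullet> b \<le> u \<bullet> b"
  then have le': "l $ i \<le> u $ i" for i
    by (metis axis_in_Basis_iff cart_eq_inner_axis Basis_real_def singletonI)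
  have "emeasure (distr ?M borel (\<lambda>f. \<chi> i. f i)) (box l u)
      = emeasure ?M (Pi\<^sub>E UNIV (\<lambda>i. {l $ i<..<u $ i}))"
    by (subst emeasure_distr) (auto simp: mem_box_cart space_PiM PiE_def Pi_iff intro!: arg_cong2[where f=emeasure])
  also have "\<dots> = (\<Prod>i\<in>UNIV. ennreal (u $ i - l $ i))"
    by (subst emeasure_PiM) (auto simp: le')
  also have "\<dots> = (\<Prod>b\<in>Basis. (u - l) \<bullet> b)"
    by (simp add: Basis_vec_def UNION_singleton_eq_range prod.reindex inj_on_def axis_eq_axis
        inner_axis prod_ennreal le')
  finally show "emeasure (distr ?M borel (\<lambda>f. \<chi> i. f i)) (box l u) = (\<Prod>b\<in>Basis. (u - l) \<bullet> b)" .
qed simp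

lemma borel_measurable_insert_coordinate [measurable]:
  fixes k :: "'n::finite"
  shows "(\<lambda>(w, p). (\<chi> i. if i = k then w else p i)) \<in>
    lborel \<Otimes>\<^sub>M Pi\<^sub>M (UNIV - {k}) (\<lambda>_. lborel :: real measure) \<rightarrow>\<^sub>M (borel :: (real^'n) measure)"
proof (subst borel_measurable_euclidean_space, rule ballI)
  fix b :: "real^'n" assume "b \<in> Basis"
  then obtain i where b: "b = axis i 1" by (auto simp: Basis_vec_def)
  show "(\<lambda>x. (case x of (w, p) \<Rightarrow> \<chi> i. if i = k then w else p i) \<bullet> b) \<in> borel_measurable (lborel \<Otimes>\<^sub>M Pi\<^sub>M (UNIV - {k}) (\<lambda>_. lborel :: real measure))"
    unfolding b case_prod_beta by (cases "i = k") (simp_all add: inner_axis)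
qed

lemma borel_measurable_reduced_kernel:
  fixes \<rho> :: "real ^ 'n::finite \<Rightarrow> real"
  assumes int: "integrable lborel \<rho>"
  shows "reduced_kernel k \<rho> \<in> borel_measurable borel"
proof -
  interpret product_sigma_finite "\<lambda>_::'n. lborel :: real measure" by standard
  interpret P: sigma_finite_measure "Pi\<^sub>M (UNIV - {k}) (\<lambda>_. lborel :: real measure)"
    by (rule sigma_finite) simp
  have [measurable]: "\<rho> \<in> borel_measurable borel" using int by auto
  show ?thesis
    unfolding reduced_kernel_def by measurable
qed

text \<open>
  By Tonelli, the inner integral of \<open>\<rho>\<close> over the coordinates other than \<open>k\<close> is finite for almost every
  value of the \<open>k\<close>-th one; there it agrees with the Bochner integral that defines the reduced kernel.
\<close>

lemma marginal_density:
  fixes \<rho> :: "real ^ 'n::finite \<Rightarrow> real"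
  assumes int: "integrable lborel \<rho>" and nonneg: "\<And>x. \<rho> x \<ge> 0"
  shows "distr (density lborel \<rho>) borel (\<lambda>v. v $ k) = density lborel (reduced_kernel k \<rho>)"
proof (rule measure_eqI)
  interpret product_sigma_finite "\<lambda>_::'n. lborel :: real measure" by standard
  let ?I = "UNIV - {k}"
  let ?P = "Pi\<^sub>M ?I (\<lambda>_. lborel :: real measure)"
  let ?M = "Pi\<^sub>M UNIV (\<lambda>_::'n. lborel :: real measure)"
  interpret P: sigma_finite_measure ?P by (rule sigma_finite) simp
  have [measurable]: "\<rho> \<in> borel_measurable borel" using int by auto
  have J [measurable]: "(\<lambda>f. \<chi> i. f i) \<in> ?M \<rightarrow>\<^sub>M (borel :: (real^'n) measure)"
    by (subst borel_measurable_euclidean_space) (auto simp: Basis_vec_def inner_axis)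
  have disint: "(\<integral>\<^sup>+v. f v \<partial>lborel) = (\<integral>\<^sup>+w. (\<integral>\<^sup>+p. f (\<chi> i. if i = k then w else p i) \<partial>?P) \<partial>lborel)"
    if [measurable]: "f \<in> borel_measurable borel" for f :: "real^'n \<Rightarrow> ennreal"
  proof -
    have "(\<integral>\<^sup>+v. f v \<partial>lborel) = (\<integral>\<^sup>+g. f (\<chi> i. g i) \<partial>?M)"
      by (subst distr_PiM_lborel_vec[symmetric], subst nn_integral_distr) auto
    also have "\<dots> = (\<integral>\<^sup>+w. (\<integral>\<^sup>+p. f (\<chi> i. (p(k := w)) i) \<partial>?P) \<partial>lborel)"
      using product_nn_integral_insert_rev[of ?I k "\<lambda>g. f (\<chi> i. g i)"] by (simp add: insert_absorb)
    finally show ?thesis by (simp add: fun_upd_def)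
  qed
  note [measurable] = borel_measurable_reduced_kernel[OF int]
  have "(\<integral>\<^sup>+w. (\<integral>\<^sup>+p. \<rho> (\<chi> i. if i = k then w else p i) \<partial>?P) \<partial>lborel) \<noteq> \<infinity>"
    using int nonneg by (subst disint[symmetric]) (auto simp: integrable_iff_bounded)
  then have "AE w in lborel. (\<integral>\<^sup>+p. \<rho> (\<chi> i. if i = k then w else p i) \<partial>?P) \<noteq> \<infinity>"
    by (intro nn_integral_PInf_AE) auto
  then have AE: "AE w in lborel. (\<integral>\<^sup>+p. \<rho> (\<chi> i. if i = k then w else p i) \<partial>?P) = ennreal (reduced_kernel k \<rho> w)"
  proof eventually_elim
    case (elim w)
    have "integrable ?P (\<lambda>p. \<rho> (\<chi> i. if i = k then w else p i))"
      using elim nonneg by (intro integrableI_nonneg) (auto simp: less_top)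
    then show ?case unfolding reduced_kernel_def
      using nonneg by (intro nn_integral_eq_integral) auto
  qed
  fix A assume "A \<in> sets (distr (density lborel \<rho>) borel (\<lambda>v. v $ k))"
  then have [measurable]: "A \<in> sets borel" by simp
  have "(\<lambda>v. v $ k) -` A \<in> sets (borel :: (real^'n) measure)"
    using measurable_sets[of "\<lambda>v. v $ k" "borel :: (real^'n) measure" borel A] by simp
  then have "emeasure (distr (density lborel \<rho>) borel (\<lambda>v. v $ k)) A
      = (\<integral>\<^sup>+v. ennreal (\<rho> v) * indicator A (v $ k) \<partial>lborel)"
    by (subst emeasure_distr, simp, simp, subst emeasure_density) (auto simp: indicator_def intro!: nn_integral_cong)
  also have "\<dots> = (\<integral>\<^sup>+w. (\<integral>\<^sup>+p. ennreal (\<rho> (\<chi> i. if i = k then w else p i)) * indicator A w \<partial>?P) \<partial>lborel)"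
    by (subst disint) auto
  also have "\<dots> = (\<integral>\<^sup>+w. (\<integral>\<^sup>+p. \<rho> (\<chi> i. if i = k then w else p i) \<partial>?P) * indicator A w \<partial>lborel)"
    by (rule nn_integral_cong, rule nn_integral_multc) auto
  also have "\<dots> = (\<integral>\<^sup>+w. ennreal (reduced_kernel k \<rho> w) * indicator A w \<partial>lborel)"
    using AE by (intro nn_integral_cong_AE) auto
  also have "\<dots> = emeasure (density lborel (reduced_kernel k \<rho>)) A"
    by (subst emeasure_density) auto
  finally show "emeasure (distr (density lborel \<rho>) borel (\<lambda>v. v $ k)) A = emeasure (density lborel (reduced_kernel k \<rho>)) A" .
qed simp

lemma measure_preserving_integral:
  fixes f :: "'a::euclidean_space \<Rightarrow> real"
  assumes T: "distr lborel borel T = lborel" and [measurable]: "T \<in> borel_measurable borel"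
    and [measurable]: "f \<in> borel_measurable borel"
  shows "integrable lborel (\<lambda>x. f (T x)) \<longleftrightarrow> integrable lborel f"
    and "(\<integral>x. f (T x) \<partial>lborel) = (\<integral>x. f x \<partial>lborel)"
proof -
  show "integrable lborel (\<lambda>x. f (T x)) \<longleftrightarrow> integrable lborel f"
    by (subst T[symmetric], subst integrable_distr_eq) auto
  show "(\<integral>x. f (T x) \<partial>lborel) = (\<integral>x. f x \<partial>lborel)"
    using integral_distr[of T lborel borel f] by (simp add: T)
qed

text \<open>
  Both sides are integrals of \<open>h\<close>, against the marginal of the measure with density \<open>\<rho>\<close> and, pulled
  back, against that measure itself. So absolute convergence transfers along with the value.
\<close>

lemma integral_marginal:
  fixes \<rho> :: "real ^ 'n::finite \<Rightarrow> real"
  assumes int: "integrable lborel \<rho>" and nonneg: "\<And>x. \<rho> x \<ge> 0"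
    and [measurable]: "h \<in> borel_measurable borel"
  shows "integrable lborel (\<lambda>w. reduced_kernel k \<rho> w * h w) \<longleftrightarrow> integrable lborel (\<lambda>v. \<rho> v * h (v $ k))"
    and "(\<integral>w. reduced_kernel k \<rho> w * h w \<partial>lborel) = (\<integral>v. \<rho> v * h (v $ k) \<partial>lborel)"
proof -
  have [measurable]: "\<rho> \<in> borel_measurable borel" using int by auto
  note [measurable] = borel_measurable_reduced_kernel[OF int]
  have red: "reduced_kernel k \<rho> w \<ge> 0" for w
    unfolding reduced_kernel_def by (simp add: nonneg)
  have "integrable lborel (\<lambda>w. reduced_kernel k \<rho> w * h w)
    \<longleftrightarrow> integrable (density lborel (reduced_kernel k \<rho>)) h"
    by (subst integrable_density) (auto simp: red)
  also have "\<dots> \<longleftrightarrow> integrable (density lborel \<rho>) (\<lambda>v. h (v $ k))"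
    by (subst marginal_density[OF int nonneg, symmetric], subst integrable_distr_eq) auto
  also have "\<dots> \<longleftrightarrow> integrable lborel (\<lambda>v. \<rho> v * h (v $ k))"
    by (subst integrable_density) (auto simp: nonneg)
  finally show "integrable lborel (\<lambda>w. reduced_kernel k \<rho> w * h w) \<longleftrightarrow> integrable lborel (\<lambda>v. \<rho> v * h (v $ k))" .
  have "(\<integral>w. reduced_kernel k \<rho> w * h w \<partial>lborel) = (\<integral>w. h w \<partial>density lborel (reduced_kernel k \<rho>))"
    by (subst integral_density) (auto simp: red)
  also have "\<dots> = (\<integral>v. h (v $ k) \<partial>density lborel \<rho>)"
    by (subst marginal_density[OF int nonneg, symmetric], subst integral_distr) auto
  also have "\<dots> = (\<integral>v. \<rho> v * h (v $ k) \<partial>lborel)"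
    by (subst integral_density) (auto simp: nonneg)
  finally show "(\<integral>w. reduced_kernel k \<rho> w * h w \<partial>lborel) = (\<integral>v. \<rho> v * h (v $ k) \<partial>lborel)" .
qed

text \<open>
  A reflection that takes \<open>e\<close> to the \<open>k\<close>-th unit vector preserves both Lebesgue measure and \<open>\<rho>\<close>, so the
  \<open>k\<close>-th marginal of \<open>\<rho>\<close> is its marginal in every direction.
\<close>

lemma radial_integral_direction:
  fixes \<rho> :: "real ^ 'n::finite \<Rightarrow> real"
  assumes int: "integrable lborel \<rho>" and nonneg: "\<And>x. \<rho> x \<ge> 0"
    and radial: "\<And>x y. norm x = norm y \<Longrightarrow> \<rho> x = \<rho> y"
    and [measurable]: "h \<in> borel_measurable borel" and e: "norm e = 1"
  shows "integrable lborel (\<lambda>w. reduced_kernel k \<rho> w * h w) \<longleftrightarrow> integrable lborel (\<lambda>v. \<rho> v * h (v \<bullet> e))"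
    and "(\<integral>w. reduced_kernel k \<rho> w * h w \<partial>lborel) = (\<integral>v. \<rho> v * h (v \<bullet> e) \<partial>lborel)"
proof -
  have [measurable]: "\<rho> \<in> borel_measurable borel" using int by auto
  let ?R = "reflection (e - axis k 1)"
  have "?R v $ k = v \<bullet> e" for v
  proof -
    have "?R v \<bullet> ?R e = ?R v \<bullet> axis k 1"
      using e by (subst reflection_swap) auto
    then show ?thesis by (simp add: inner_reflection inner_axis)
  qed
  then have eq: "\<rho> v * h (v \<bullet> e) = \<rho> (?R v) * h (?R v $ k)" for v
    by (simp add: radial[of "?R v" v] norm_reflection)
  show "integrable lborel (\<lambda>w. reduced_kernel k \<rho> w * h w) \<longleftrightarrow> integrable lborel (\<lambda>v. \<rho> v * h (v \<bullet> e))"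
    unfolding integral_marginal(1)[OF int nonneg assms(4)] eq
    by (rule measure_preserving_integral(1)[symmetric]) (auto simp: lborel_distr_reflection)
  show "(\<integral>w. reduced_kernel k \<rho> w * h w \<partial>lborel) = (\<integral>v. \<rho> v * h (v \<bullet> e) \<partial>lborel)"
    unfolding integral_marginal(2)[OF int nonneg assms(4)] eq
    by (rule measure_preserving_integral(2)[symmetric]) (auto simp: lborel_distr_reflection)
qed

section \<open>Coupling by reflection\<close>

lemma nonlocal_op_reflection:
  fixes \<rho> f :: "'a::euclidean_space \<Rightarrow> real"
  assumes [measurable]: "\<rho> \<in> borel_measurable borel" "f \<in> borel_measurable borel"
    and radial: "\<And>x y. norm x = norm y \<Longrightarrow> \<rho> x = \<rho> y"
  shows "integrable lborel (\<lambda>v. \<rho> v * (f (x + reflection d v) - f x))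
      \<longleftrightarrow> integrable lborel (nonlocal_integrand \<rho> f x)"
    and "(\<integral>v. \<rho> v * (f (x + reflection d v) - f x) \<partial>lborel) = nonlocal_op \<rho> f x"
proof -
  let ?T = "\<lambda>v. x + reflection d v"
  have [measurable]: "nonlocal_integrand \<rho> f x \<in> borel_measurable borel"
    unfolding nonlocal_integrand_def by measurable
  have "distr lborel borel ?T = distr (distr lborel borel (reflection d)) borel ((+) x)"
    by (subst distr_distr) (auto simp: o_def)
  then have T: "distr lborel borel ?T = lborel"
    by (simp add: lborel_distr_reflection lborel_distr_plus)
  have eq: "(\<lambda>v. \<rho> v * (f (?T v) - f x)) = (\<lambda>v. nonlocal_integrand \<rho> f x (?T v))"
    by (auto simp: nonlocal_integrand_def fun_eq_iff intro!: radial simp: norm_reflection)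
  show "integrable lborel (\<lambda>v. \<rho> v * (f (?T v) - f x))
      \<longleftrightarrow> integrable lborel (nonlocal_integrand \<rho> f x)"
    unfolding eq by (rule measure_preserving_integral(1)[OF T]) auto
  show "(\<integral>v. \<rho> v * (f (?T v) - f x) \<partial>lborel) = nonlocal_op \<rho> f x"
    unfolding eq nonlocal_op_def by (rule measure_preserving_integral(2)[OF T]) auto
qed

lemma nonlocal_op_translation:
  fixes \<rho> f :: "'a::euclidean_space \<Rightarrow> real"
  assumes "\<rho> \<in> borel_measurable borel" "f \<in> borel_measurable borel"
    and "\<And>x y. norm x = norm y \<Longrightarrow> \<rho> x = \<rho> y"
  shows "integrable lborel (\<lambda>v. \<rho> v * (f (x + v) - f x))
      \<longleftrightarrow> integrable lborel (nonlocal_integrand \<rho> f x)"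
    and "(\<integral>v. \<rho> v * (f (x + v) - f x) \<partial>lborel) = nonlocal_op \<rho> f x"
  using nonlocal_op_reflection[OF assms, where d = 0] by (simp_all add: reflection_def)

text \<open>
  Twice the integral of \<open>G\<close> is the integral of \<open>G + G \<circ> T\<close>, in which positive values of \<open>G\<close> can cancel.
\<close>

lemma integral_nonpos_by_symmetrization:
  fixes G :: "'a::euclidean_space \<Rightarrow> real"
  assumes T: "distr lborel borel T = lborel" "T \<in> borel_measurable borel"
    and G: "integrable lborel G"
    and le: "AE v in lborel. G v + G (T v) \<le> 0"
  shows "(\<integral>v. G v \<partial>lborel) \<le> 0"
proof -
  have meas: "G \<in> borel_measurable borel" using G by auto
  have int: "integrable lborel (\<lambda>v. G (T v))"
    using measure_preserving_integral(1)[OF T meas] G by simp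
  have "(\<integral>v. G v \<partial>lborel) + (\<integral>v. G v \<partial>lborel) = (\<integral>v. G v + G (T v) \<partial>lborel)"
    using measure_preserving_integral(2)[OF T meas] G int by simp
  also have "\<dots> \<le> 0"
    using integral_mono_AE[of lborel "\<lambda>v. G v + G (T v)" "\<lambda>_. 0"] G int le by simp
  finally show ?thesis by simp
qed

text \<open>
  At a pair of points where the two-point inequality \<open>bound\<close> is an equality, the jumps from \<open>y\<close> are
  paired with the mirror images of the jumps from \<open>x\<close>: \<open>y + v\<close> is compared with \<open>x + R v\<close>, where \<open>R\<close>
  reflects along \<open>y - x\<close>. These points are mirror images in the bisector of \<open>x\<close> and \<open>y\<close>, at signed
  distance \<open>r + v \<bullet> e\<close> from it. On the side of \<open>y\<close> the excess \<open>D\<close> of the difference of \<open>u\<close> over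
  the modulus is at most the corresponding sum \<open>W\<close> of values of \<open>w\<close>, by \<open>bound\<close>; but on the other
  side, where \<open>D\<close> changes sign, the inequality points the wrong way. The involution
  \<open>v \<mapsto> R v - (y - x)\<close> exchanges the two sides, and the kernel has more mass on the side of \<open>y\<close> because it
  is non-increasing; so the favourable contribution outweighs the other one.
\<close>

lemma nonlocal_op_reflection_coupling:
  fixes \<rho> u w :: "'a::euclidean_space \<Rightarrow> real" and g :: "real \<Rightarrow> real"
  assumes [measurable]: "\<rho> \<in> borel_measurable borel" and nonneg: "\<And>x. \<rho> x \<ge> 0"
    and radial: "\<And>x y. norm x = norm y \<Longrightarrow> \<rho> x = \<rho> y"
    and nonincreasing: "\<And>x y. 0 < norm x \<Longrightarrow> norm x \<le> norm y \<Longrightarrow> \<rho> y \<le> \<rho> x"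
    and [measurable]: "u \<in> borel_measurable borel" "w \<in> borel_measurable borel"
    and w_nonneg: "\<And>x. w x \<ge> 0" and odd: "\<And>s. g (- s) = - g s"
    and xy: "x \<noteq> y" and r: "r = norm (y - x) / 2" and e: "e = (y - x) /\<^sub>R norm (y - x)"
    and u_int: "integrable lborel (nonlocal_integrand \<rho> u x)" "integrable lborel (nonlocal_integrand \<rho> u y)"
    and w_int: "integrable lborel (nonlocal_integrand \<rho> w x)" "integrable lborel (nonlocal_integrand \<rho> w y)"
    and g_int: "integrable lborel (\<lambda>v. \<rho> v * (g (r + v \<bullet> e) - g r))"
    and bound: "\<And>a b. u b - u a \<le> 2 * g (norm (b - a) / 2) + w a + w b"
    and touch: "u y - u x = 2 * g r + w x + w y"
  shows "nonlocal_op \<rho> u y - nonlocal_op \<rho> u x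
    \<le> 2 * (\<integral>v. \<rho> v * (g (r + v \<bullet> e) - g r) \<partial>lborel) + nonlocal_op \<rho> w x + nonlocal_op \<rho> w y"
proof -
  let ?R = "reflection (y - x)"
  define N where "N = norm (y - x)"
  have N: "N > 0" and rN: "r = N / 2" and d: "y - x = N *\<^sub>R e" and ee: "e \<bullet> e = 1"
    using xy by (auto simp: N_def r e dot_square_norm power2_eq_square)
  have R: "?R v = v - (2 * (v \<bullet> e)) *\<^sub>R e" for v
    using N unfolding reflection_def d by (simp add: ee)
  let ?T = "\<lambda>v. ?R v - (y - x)"
  define D where "D v = u (y + v) - u (x + ?R v) - 2 * g (r + v \<bullet> e)" for v
  define W where "W v = w (y + v) + w (x + ?R v)" for v
  define G where "G v = \<rho> v * (D v - W v)" for v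
  have Te: "?T v = v - (2 * (r + v \<bullet> e)) *\<^sub>R e" for v
    unfolding R by (simp add: d rN algebra_simps)
  have y: "y = x + N *\<^sub>R e" using d by (simp add: algebra_simps)
  have T: "y + ?T v = x + ?R v" "x + ?R (?T v) = y + v" "r + ?T v \<bullet> e = - (r + v \<bullet> e)" for v
  proof -
    show "y + ?T v = x + ?R v" by simp
    show "x + ?R (?T v) = y + v"
      unfolding Te R using scaleR_add_left[of N N e] by (simp add: y inner_diff_left ee rN algebra_simps)
    show "r + ?T v \<bullet> e = - (r + v \<bullet> e)"
      unfolding Te by (simp add: inner_diff_left ee)
  qed
  have normT: "(norm (?T v))\<^sup>2 = (norm v)\<^sup>2 + 4 * r * (r + v \<bullet> e)" for v
    unfolding power2_norm_eq_inner Te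
    by (simp add: inner_diff_left inner_diff_right inner_commute[of e v] ee rN field_simps power2_eq_square)
  have DT: "D (?T v) = - D v" and WT: "W (?T v) = W v" for v
    unfolding D_def W_def T odd by simp_all
  have W0: "W v \<ge> 0" for v by (simp add: W_def w_nonneg)
  have D_le: "D v \<le> W v" if "r + v \<bullet> e \<ge> 0" for v
  proof -
    have "y + v - (x + ?R v) = (2 * (r + v \<bullet> e)) *\<^sub>R e"
      using d unfolding R by (simp add: rN algebra_simps)
    then have dist: "norm (y + v - (x + ?R v)) / 2 = r + v \<bullet> e"
      using that ee by (simp add: norm_eq_sqrt_inner)
    show ?thesis
      using bound[of "y + v" "x + ?R v"] unfolding dist D_def W_def by linarith
  qed
  \<comment> \<open>On the side of \<open>y\<close> the sum is at most \<open>(\<rho> v - \<rho> (T v)) W - (\<rho> v + \<rho> (T v)) W = - 2 \<rho> (T v) W\<close>.\<close>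
  have half: "G v + G (?T v) \<le> 0" if "r + v \<bullet> e \<ge> 0" "v \<noteq> 0" for v
  proof -
    have "(norm v)\<^sup>2 \<le> (norm (?T v))\<^sup>2"
      using that(1) N by (simp add: normT rN)
    then have "\<rho> (?T v) \<le> \<rho> v"
      using that(2) by (intro nonincreasing) (auto simp: power2_le_iff_abs_le)
    then have "(\<rho> v - \<rho> (?T v)) * D v \<le> (\<rho> v - \<rho> (?T v)) * W v"
      using D_le[OF that(1)] by (intro mult_left_mono) auto
    moreover have "\<rho> (?T v) * W v \<ge> 0" using nonneg W0 by simp
    ultimately show ?thesis
      unfolding G_def DT WT by (simp add: algebra_simps)
  qed
  have TT: "?T (?T v) = v" for v
  proof -
    have "?T (?T v) = x + ?R (?T v) - y"
      by (simp only: diff_diff_eq2 add.commute)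
    then show ?thesis by (simp add: T(2))
  qed
  have pair: "G v + G (?T v) \<le> 0" if "v \<noteq> 0" "?T v \<noteq> 0" for v
  proof (cases "r + v \<bullet> e \<ge> 0")
    case True then show ?thesis using half that by blast
  next
    case False
    then have "r + ?T v \<bullet> e \<ge> 0" by (simp add: T(3))
    from half[OF this that(2)] show ?thesis by (simp add: TT)
  qed
  have "distr lborel borel ?T = distr (distr lborel borel ?R) borel ((+) (x - y))"
    by (subst distr_distr) (auto simp: o_def algebra_simps)
  then have preserve: "distr lborel borel ?T = lborel"
    by (simp add: lborel_distr_reflection lborel_distr_plus)
  \<comment> \<open>Monotonicity of \<open>\<rho>\<close> says nothing about its value at 0, which costs the two points
      where \<open>v\<close> or its image vanishes.\<close>
  have ae: "AE v in lborel. G v + G (?T v) \<le> 0"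
    using AE_lborel_singleton[of 0] AE_lborel_singleton[of "?T 0"]
  proof eventually_elim
    case (elim v)
    have "?T v \<noteq> 0" using TT[of v] elim(2) by metis
    with elim(1) show ?case by (rule pair)
  qed
  note shift = nonlocal_op_translation[OF assms(1) _ radial, of _ y]
  note refl = nonlocal_op_reflection[OF assms(1) _ radial, of _ x "y - x"]
  let ?uy = "\<lambda>v. \<rho> v * (u (y + v) - u y)" and ?ux = "\<lambda>v. \<rho> v * (u (x + ?R v) - u x)"
  let ?wy = "\<lambda>v. \<rho> v * (w (y + v) - w y)" and ?wx = "\<lambda>v. \<rho> v * (w (x + ?R v) - w x)"
  let ?g = "\<lambda>v. \<rho> v * (g (r + v \<bullet> e) - g r)"
  have ints: "integrable lborel ?uy" "integrable lborel ?ux" "integrable lborel ?wy" "integrable lborel ?wx"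
    using shift(1) refl(1) u_int w_int by auto
  have G: "G = (\<lambda>v. ?uy v - ?ux v - 2 * ?g v - ?wy v - ?wx v)"
  proof
    fix v
    have "D v - W v = (u (y + v) - u y) - (u (x + ?R v) - u x) - 2 * (g (r + v \<bullet> e) - g r)
        - (w (y + v) - w y) - (w (x + ?R v) - w x)"
      using touch by (simp add: D_def W_def)
    then have "G v = \<rho> v * ((u (y + v) - u y) - (u (x + ?R v) - u x) - 2 * (g (r + v \<bullet> e) - g r)
        - (w (y + v) - w y) - (w (x + ?R v) - w x))"
      by (simp only: G_def)
    then show "G v = ?uy v - ?ux v - 2 * ?g v - ?wy v - ?wx v"
      by (simp add: algebra_simps)
  qed
  have "integrable lborel G"
    unfolding G using ints g_int by (intro Bochner_Integration.integrable_diff integrable_mult_right) auto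
  moreover have "?T \<in> borel_measurable borel" by measurable
  ultimately have "(\<integral>v. G v \<partial>lborel) \<le> 0"
    using integral_nonpos_by_symmetrization[OF preserve] ae by blast
  also have "(\<integral>v. G v \<partial>lborel) = nonlocal_op \<rho> u y - nonlocal_op \<rho> u x
      - 2 * (\<integral>v. ?g v \<partial>lborel) - nonlocal_op \<rho> w y - nonlocal_op \<rho> w x"
    unfolding G using ints g_int shift(2) refl(2) by simp
  finally show ?thesis by simp
qed

section \<open>Touching points and their derivatives\<close>

lemma esssup_abs_le_imp_le:
  fixes f :: "'a::euclidean_space \<Rightarrow> real"
  assumes cont: "continuous_on UNIV f" and le: "esssup lborel (\<lambda>x. ereal \<bar>f x\<bar>) \<le> ereal b"
  shows "\<bar>f x\<bar> \<le> b"
proof (rule ccontr)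
  let ?S = "{x. b < \<bar>f x\<bar>}"
  assume "\<not> \<bar>f x\<bar> \<le> b"
  then have ne: "?S \<noteq> {}" using not_le by blast
  have op: "open ?S"
    by (intro open_Collect_less continuous_intros cont)
  have "AE x in lborel. ereal \<bar>f x\<bar> \<le> esssup lborel (\<lambda>x. ereal \<bar>f x\<bar>)"
    by (rule esssup_AE)
  then have "AE x in lborel. x \<notin> ?S"
  proof eventually_elim
    case (elim x)
    then have "ereal \<bar>f x\<bar> \<le> ereal b" using le by (rule order_trans)
    then show ?case by simp
  qed
  then have "?S \<in> null_sets lborel"
    using op by (subst AE_iff_null_sets) auto
  then have "negligible ?S"
    by (simp add: negligible_iff_null_sets null_sets_completionI)
  with open_not_negligible[OF op ne] show False by simp
qed

lemma grad_eqI: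
  assumes "GDERIV f x :> D" shows "grad f x = D"
  unfolding grad_def
proof (rule the_equality)
  show "GDERIV f x :> D" by (rule assms)
next
  fix D' assume "GDERIV f x :> D'"
  then have "(\<lambda>h. h \<bullet> D') = (\<lambda>h. h \<bullet> D)"
    using assms unfolding gderiv_def by (rule has_derivative_unique)
  then have "(D' - D) \<bullet> D' = (D' - D) \<bullet> D" by metis
  then show "D' = D"
    by (metis inner_diff_right inner_eq_zero_iff right_minus_eq)
qed

lemma GDERIV_grad:
  fixes f :: "'a::euclidean_space \<Rightarrow> real"
  assumes "f differentiable (at x)" shows "GDERIV f x :> grad f x"
proof -
  obtain f' where f': "(f has_derivative f') (at x)"
    using assms by (auto simp: differentiable_def)
  have "f' = (\<lambda>h. h \<bullet> (\<Sum>b\<in>Basis. f' b *\<^sub>R b))"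
  proof
    fix h
    have lin: "linear f'" using f' by (rule has_derivative_linear)
    have "f' h = f' (\<Sum>b\<in>Basis. (h \<bullet> b) *\<^sub>R b)" by (simp add: euclidean_representation)
    also have "\<dots> = (\<Sum>b\<in>Basis. (h \<bullet> b) *\<^sub>R f' b)"
      by (simp add: linear_sum[OF lin] linear_scale[OF lin])
    finally show "f' h = h \<bullet> (\<Sum>b\<in>Basis. f' b *\<^sub>R b)"
      by (simp add: inner_sum_right mult.commute)
  qed
  then have "GDERIV f x :> (\<Sum>b\<in>Basis. f' b *\<^sub>R b)"
    using f' by (simp add: gderiv_def)
  then show ?thesis using grad_eqI by metis
qed

text \<open>
  The function \<open>f - 2 h(\<bar>\<cdot> - x\<bar> / 2) - w\<close> has a maximum at \<open>y\<close>, away from the point \<open>x\<close> where the norm is not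
  differentiable.
\<close>

lemma grad_at_touching_point:
  fixes f w :: "'a::euclidean_space \<Rightarrow> real"
  assumes f: "f differentiable (at y)" and w: "w differentiable (at y)"
    and h: "(h has_real_derivative h') (at (norm (y - x) / 2))" and xy: "x \<noteq> y"
    and bound: "\<And>z. f z \<le> c + 2 * h (norm (z - x) / 2) + w z"
    and touch: "f y = c + 2 * h (norm (y - x) / 2) + w y"
  shows "grad f y = h' *\<^sub>R sgn (y - x) + grad w y"
proof -
  have "GDERIV (\<lambda>z. norm (z - x)) y :> sgn (y - x)"
  proof -
    have "((\<lambda>z. norm (z - x)) has_derivative (\<lambda>k. k \<bullet> sgn (y - x))) (at y)"
    proof (rule has_derivative_compose[where g = norm and f = "\<lambda>z. z - x", simplified])
      show "((\<lambda>z. z - x) has_derivative (\<lambda>k. k)) (at y)"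
        by (auto intro!: derivative_eq_intros)
      show "(norm has_derivative (\<lambda>k. k \<bullet> sgn (y - x))) (at (y - x))"
        using xy by (intro has_derivative_norm) simp
    qed
    then show ?thesis by (simp add: gderiv_def)
  qed
  moreover have "((\<lambda>s. 2 * h (s / 2)) has_real_derivative h') (at (norm (y - x)))"
    using h by (auto intro!: derivative_eq_intros DERIV_chain'[of "\<lambda>s. s / 2"])
  ultimately have "GDERIV (\<lambda>z. 2 * h (norm (z - x) / 2)) y :> h' *\<^sub>R sgn (y - x)"
    using GDERIV_DERIV_compose by blast
  then have D: "GDERIV (\<lambda>z. f z - 2 * h (norm (z - x) / 2) - w z) y
      :> grad f y - h' *\<^sub>R sgn (y - x) - grad w y"
    by (intro GDERIV_diff GDERIV_grad f w)
  then have "(\<lambda>k. k \<bullet> (grad f y - h' *\<^sub>R sgn (y - x) - grad w y)) = (\<lambda>k. 0)"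
    unfolding gderiv_def
  proof (rule has_derivative_local_max)
    have "f z - 2 * h (norm (z - x) / 2) - w z \<le> f y - 2 * h (norm (y - x) / 2) - w y" for z
      using bound[of z] touch by simp
    then show "\<forall>\<^sub>F z in at y. f z - 2 * h (norm (z - x) / 2) - w z
        \<le> f y - 2 * h (norm (y - x) / 2) - w y" by simp
  qed
  then have "(grad f y - h' *\<^sub>R sgn (y - x) - grad w y) \<bullet> (grad f y - h' *\<^sub>R sgn (y - x) - grad w y) = 0"
    by metis
  then have "grad f y - h' *\<^sub>R sgn (y - x) - grad w y = 0"
    by (simp only: inner_eq_zero_iff)
  then show ?thesis by (simp add: algebra_simps)
qed

text \<open>
  The times at which \<open>F\<close> is non-negative somewhere form the projection of a compact set, since \<open>F\<close> is
  negative outside \<open>K\<close>; the first of them is positive because \<open>F\<close> is negative initially. Continuity in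
  time then gives \<open>F \<le> 0\<close> at that time.
\<close>

lemma first_touching_time:
  fixes F :: "'a::t2_space \<Rightarrow> real \<Rightarrow> real"
  assumes cont: "continuous_on (UNIV \<times> {0..T}) (\<lambda>(p, t). F p t)"
    and K: "compact K" and outside: "\<And>p t. p \<notin> K \<Longrightarrow> 0 \<le> t \<Longrightarrow> t \<le> T \<Longrightarrow> F p t < 0"
    and init: "\<And>p. F p 0 < 0" and pos: "0 \<le> T" "F p0 T \<ge> 0"
  obtains p t where "0 < t" "t \<le> T" "F p t = 0" "\<And>p'. F p' t \<le> 0"
    "\<And>s. 0 \<le> s \<Longrightarrow> s < t \<Longrightarrow> F p s < 0"
proof -
  define S where "S = {z \<in> K \<times> {0..T}. (\<lambda>(p, t). F p t) z \<ge> 0}"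
  have cpt: "compact (K \<times> {0..T})" using K by (intro compact_Times) auto
  have "closed (K \<times> {0..T} \<inter> (\<lambda>(p, t). F p t) -` {0..})"
    by (intro continuous_closed_preimage continuous_on_subset[OF cont] compact_imp_closed[OF cpt]) auto
  then have "compact (K \<times> {0..T} \<inter> (K \<times> {0..T} \<inter> (\<lambda>(p, t). F p t) -` {0..}))"
    by (rule compact_Int_closed[OF cpt])
  also have "K \<times> {0..T} \<inter> (K \<times> {0..T} \<inter> (\<lambda>(p, t). F p t) -` {0..}) = S"
    by (auto simp: S_def)
  finally have "compact S" .
  moreover have "(p0, T) \<in> S"
    using pos outside[of p0 T] by (force simp: S_def)
  ultimately have "\<exists>z\<in>S. \<forall>z'\<in>S. snd z \<le> snd z'"
    by (intro continuous_attains_inf continuous_intros) auto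
  then obtain z where z: "z \<in> S" "\<And>z'. z' \<in> S \<Longrightarrow> snd z \<le> snd z'"
    by blast
  obtain p t where pt: "z = (p, t)" by force
  have t: "0 \<le> t" "t \<le> T" "F p t \<ge> 0" using z(1) by (auto simp: S_def pt)
  have before: "F p' s < 0" if "0 \<le> s" "s < t" for p' s
  proof (rule ccontr)
    assume "\<not> F p' s < 0"
    with that t have "(p', s) \<in> S" using outside[of p' s] by (force simp: S_def)
    from z(2)[OF this] that show False by (simp add: pt)
  qed
  have t0: "0 < t" using t(1,3) init[of p] by (cases "t = 0") auto
  have le: "F p' t \<le> 0" for p'
  proof -
    have "continuous_on {0..T} (\<lambda>s. F p' s)"
    proof -
      have "continuous_on {0..T} (Pair p')"
        by (intro continuous_intros)
      then have "continuous_on {0..T} (\<lambda>s. case (p', s) of (p, t) \<Rightarrow> F p t)"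
        by (rule continuous_on_compose2[OF cont]) auto
      then show ?thesis by simp
    qed
    then have "(F p' \<longlongrightarrow> F p' t) (at t within {0..T})"
      using t by (auto simp: continuous_on_def)
    then have "(F p' \<longlongrightarrow> F p' t) (at t within {0..<t})"
      by (rule tendsto_within_subset) (use t in auto)
    moreover have "at t within {0..<t} \<noteq> bot"
      using t0 by (simp add: trivial_limit_within islimpt_Ico)
    moreover have "\<forall>\<^sub>F s in at t within {0..<t}. F p' s \<le> 0"
      using before[of _ p'] by (auto simp: eventually_at_filter less_imp_le)
    ultimately show ?thesis using tendsto_upperbound by blast
  qed
  show ?thesis
    by (rule that[of t p]) (use t0 t le[of p] le before in auto)
qed

lemma DERIV_nonneg_at_left_max:
  fixes f :: "real \<Rightarrow> real"
  assumes "(f has_real_derivative l) (at t)" and "a < t" and "\<And>s. a \<le> s \<Longrightarrow> s < t \<Longrightarrow> f s \<le> f t"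
  shows "l \<ge> 0"
proof (rule ccontr)
  assume "\<not> l \<ge> 0"
  then have "\<exists>d>0. \<forall>h>0. h < d \<longrightarrow> f t < f (t - h)"
    using DERIV_neg_dec_left[OF assms(1)] by simp
  then obtain d where d: "d > 0" "\<And>h. h > 0 \<Longrightarrow> h < d \<Longrightarrow> f t < f (t - h)"
    by blast
  define h where "h = min (d / 2) (t - a)"
  have h: "0 < h" "h < d" "a \<le> t - h" "t - h < t"
    using d(1) assms(2) by (simp_all add: h_def min_def)
  show False
    using d(2)[OF h(1,2)] assms(3)[OF h(3,4)] by simp
qed

lemma lipschitz_of_deriv_bound:
  fixes q :: "real \<Rightarrow> real"
  assumes "\<And>p. p \<ge> 0 \<Longrightarrow> (q has_real_derivative q' p) (at p within {0..})"
    and "\<And>p. p \<ge> 0 \<Longrightarrow> \<bar>q' p\<bar> \<le> c" and "a \<ge> 0" "b \<ge> 0"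
  shows "\<bar>q a - q b\<bar> \<le> c * \<bar>a - b\<bar>"
proof -
  have "norm (q a - q b) \<le> c * norm (a - b)"
    by (rule field_differentiable_bound[of "{0..}" q q' c]) (use assms in auto)
  then show ?thesis by simp
qed

section \<open>The comparison theorem\<close>

lemma borel_measurable_odd_ext:
  assumes "continuous_on {0..} v"
  shows "odd_ext v \<in> borel_measurable borel"
proof -
  have "continuous_on UNIV (\<lambda>r. v \<bar>r\<bar>)"
    by (rule continuous_on_compose2[OF assms]) (auto intro!: continuous_intros)
  then have [measurable]: "(\<lambda>r. v \<bar>r\<bar>) \<in> borel_measurable borel"
    by (rule borel_measurable_continuous_onI)
  have "odd_ext v = (\<lambda>r. if r \<ge> 0 then v \<bar>r\<bar> else - v \<bar>r\<bar>)"
    by (auto simp: odd_ext_def fun_eq_iff)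
  then show ?thesis by simp
qed

lemma nonlocal_integrand_cmult:
  "nonlocal_integrand \<rho> (\<lambda>x. m * f x) x = (\<lambda>z. m * nonlocal_integrand \<rho> f x z)"
  by (auto simp: nonlocal_integrand_def fun_eq_iff algebra_simps)

lemma nonlocal_op_cmult: "nonlocal_op \<rho> (\<lambda>x. m * f x) x = m * nonlocal_op \<rho> f x"
  by (simp add: nonlocal_op_def nonlocal_integrand_cmult)

lemma smooth_on_imp_differentiable: "smooth_on S f \<Longrightarrow> x \<in> S \<Longrightarrow> f differentiable (at x)"
  unfolding smooth_on_def using Ck_on.simps(2) by blast


theorem theorem4p2:
  fixes \<rho> :: "real ^ 'n::finite \<Rightarrow> real"
    and k :: 'n
    and u :: "real ^ 'n \<Rightarrow> real \<Rightarrow> real"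
    and u0 :: "real ^ 'n \<Rightarrow> real"
    and q q' :: "real \<Rightarrow> real"
    and c :: real
    and \<phi> \<phi>' :: "real \<Rightarrow> real \<Rightarrow> real"
    and \<Psi> :: "real ^ 'n \<Rightarrow> real"
  assumes rho_L1: "integrable lborel \<rho>"
    and rho_nonneg: "\<And>x. \<rho> x \<ge> 0"
    and rho_radial: "\<And>x y. norm x = norm y \<Longrightarrow> \<rho> x = \<rho> y"
    and rho_nonincreasing: "\<And>x y. 0 < norm x \<Longrightarrow> norm x \<le> norm y \<Longrightarrow> \<rho> y \<le> \<rho> x"
    and rho_decay: "(\<rho> \<longlongrightarrow> 0) at_infinity"
    and u_smooth: "smooth_on (UNIV \<times> {0<..}) (\<lambda>(x, t). u x t)"
    and u_cont: "continuous_on (UNIV \<times> {0..}) (\<lambda>(x, t). u x t)"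
    and u_L_conv: "\<And>x t. t > 0 \<Longrightarrow> integrable lborel (nonlocal_integrand \<rho> (\<lambda>y. u y t) x)"
    and u_eq: "\<And>x t. t > 0 \<Longrightarrow>
        ((\<lambda>s. u x s) has_real_derivative
          nonlocal_op \<rho> (\<lambda>y. u y t) x + q (norm (grad (\<lambda>y. u y t) x))) (at t)"
    and u_init: "\<And>x. u x 0 = u0 x"
    and u_bound: "\<And>t. t \<ge> 0 \<Longrightarrow> esssup lborel (\<lambda>x. ereal \<bar>u x t\<bar>) \<le> 1"
    and q_mono: "mono_on {0..} q"
    and q_0: "q 0 = 0"
    and c_pos: "c > 0"
    and q_deriv: "\<And>p. p \<ge> 0 \<Longrightarrow> (q has_real_derivative q' p) (at p within {0..})"
    and q'_cont: "continuous_on {0..} q'"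
    and q'_bound: "\<And>p. p \<ge> 0 \<Longrightarrow> \<bar>q' p\<bar> \<le> c"
    and phi_nonneg: "\<And>r t. r \<ge> 0 \<Longrightarrow> t \<ge> 0 \<Longrightarrow> \<phi> r t \<ge> 0"
    and phi_cont: "continuous_on ({0..} \<times> {0..}) (\<lambda>(r, t). \<phi> r t)"
    and phi_deriv: "\<And>r t. r > 0 \<Longrightarrow> t \<ge> 0 \<Longrightarrow> ((\<lambda>s. \<phi> s t) has_real_derivative \<phi>' r t) (at r)"
    and phi'_pos: "\<And>r t. r > 0 \<Longrightarrow> t \<ge> 0 \<Longrightarrow> \<phi>' r t > 0"
    and phi_lim: "\<And>t. t \<ge> 0 \<Longrightarrow> ((\<lambda>r. \<phi> r t) \<longlongrightarrow> \<phi> 0 t) (at_right 0)"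
    and phi_0: "\<And>t. t \<ge> 0 \<Longrightarrow> \<phi> 0 t = 0"
    and phi_init: "modulus_of_continuity (\<lambda>r. \<phi> r 0) (\<lambda>x. u x 0)"
    and phi_L_conv: "\<And>r t. t > 0 \<Longrightarrow>
        integrable lborel (nonlocal1_integrand (reduced_kernel k \<rho>) (odd_ext (\<lambda>s. \<phi> s t)) r)"
    and phi_eq: "\<And>r t. t > 0 \<Longrightarrow>
        ((\<lambda>\<tau>. odd_ext (\<lambda>s. \<phi> s \<tau>) r) has_real_derivative
          nonlocal1_op (reduced_kernel k \<rho>) (odd_ext (\<lambda>s. \<phi> s t)) r) (at t)"
    and Psi_smooth: "smooth_on UNIV \<Psi>"
    and Psi_radial: "\<And>x y. norm x = norm y \<Longrightarrow> \<Psi> x = \<Psi> y"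
    and Psi_ge_1: "\<And>x. \<Psi> x \<ge> 1"
    and Psi_infinity: "filterlim \<Psi> at_top at_infinity"
    and Psi_L_conv: "\<And>x. integrable lborel (nonlocal_integrand \<rho> \<Psi> x)"
    and K_finite: "bdd_above (range (nonlocal_op \<rho> \<Psi>))"
    and K_nonneg: "0 \<le> (SUP x. nonlocal_op \<rho> \<Psi> x)"
    and K_grad_finite: "bdd_above (range (\<lambda>x. norm (grad \<Psi> x) / \<Psi> x))"
  shows "\<forall>t\<ge>0. modulus_of_continuity (\<lambda>r. \<phi> r t) (\<lambda>x. u x t)"
proof -
  define KL where "KL = (SUP x. nonlocal_op \<rho> \<Psi> x)"
  define KD where "KD = (SUP x. norm (grad \<Psi> x) / \<Psi> x)"
  define C where "C = KL + c * KD + 1"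
  have L_Psi: "nonlocal_op \<rho> \<Psi> x \<le> KL" for x
    unfolding KL_def by (rule cSUP_upper[OF _ K_finite]) simp
  have Psi_pos: "\<Psi> x > 0" for x using Psi_ge_1[of x] by linarith
  have grad_Psi: "norm (grad \<Psi> x) \<le> KD * \<Psi> x" for x
  proof -
    have "norm (grad \<Psi> x) / \<Psi> x \<le> KD"
      unfolding KD_def by (rule cSUP_upper[OF _ K_grad_finite]) simp
    then show ?thesis using Psi_pos[of x] by (simp add: field_simps)
  qed
  have KD0: "KD \<ge> 0"
    using grad_Psi[of 0] Psi_pos[of 0] norm_ge_zero[of "grad \<Psi> 0"]
    by (metis mult.commute mult_le_0_iff not_le order_trans order.strict_implies_order zero_le_mult_iff)
  have KL0: "KL \<ge> 0" using K_nonneg by (simp add: KL_def)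
  have C0: "C \<ge> 0" using KL0 KD0 c_pos by (simp add: C_def)

  have u_time_cont: "continuous_on UNIV (\<lambda>x. u x t)" if "t \<ge> 0" for t
  proof -
    have "continuous_on UNIV (\<lambda>x. case (x, t) of (x, t) \<Rightarrow> u x t)"
      by (rule continuous_on_compose2[OF u_cont]) (use that in \<open>auto intro!: continuous_intros\<close>)
    then show ?thesis by simp
  qed
  have u_le: "\<bar>u x t\<bar> \<le> 1" if "t \<ge> 0" for x t
    using esssup_abs_le_imp_le[OF u_time_cont[OF that], of 1] u_bound[OF that] by (simp add: one_ereal_def)
  have u_diff: "(\<lambda>y. u y t) differentiable (at x)" if "t > 0" for x t
  proof -
    have "(\<lambda>(x, t). u x t) differentiable (at (x, t))"
      by (rule smooth_on_imp_differentiable[OF u_smooth]) (use that in auto)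
    then have "((\<lambda>(x, t). u x t) \<circ> (\<lambda>y. (y, t))) differentiable (at x)"
      by (intro differentiable_chain_at) (auto intro!: derivative_eq_intros simp: differentiable_def)
    then show ?thesis by (simp add: o_def)
  qed
  have Psi_diff: "\<Psi> differentiable (at x)" for x
    using smooth_on_imp_differentiable[OF Psi_smooth] by simp
  have Psi_cont: "continuous_on UNIV \<Psi>"
    using Psi_diff by (simp add: continuous_at_imp_continuous_on differentiable_imp_continuous_within)
  have phi_time_cont: "continuous_on {0..} (\<lambda>r. \<phi> r t)" if "t \<ge> 0" for t
  proof -
    have "continuous_on {0..} (\<lambda>r. case (r, t) of (r, t) \<Rightarrow> \<phi> r t)"
      by (rule continuous_on_compose2[OF phi_cont]) (use that in \<open>auto intro!: continuous_intros\<close>)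
    then show ?thesis by simp
  qed
  have [measurable]: "\<rho> \<in> borel_measurable borel" using rho_L1 by auto

  \<comment> \<open>Adding a small multiple of \<open>\<Psi>\<close> makes maxima of \<open>Z\<close> exist; the factor \<open>exp (C t)\<close> makes it grow
      fast enough in time to absorb the errors that this perturbation causes.\<close>
  define Z where "Z \<epsilon> p t = u (snd p) t - u (fst p) t - 2 * \<phi> (norm (snd p - fst p) / 2) t
      - \<epsilon> * exp (C * t) * (\<Psi> (fst p) + \<Psi> (snd p))" for \<epsilon> :: real and p t

  have Z_cont: "continuous_on (UNIV \<times> {0..T}) (\<lambda>(p, t). Z \<epsilon> p t)" for \<epsilon> T
  proof -
    have u1: "continuous_on (UNIV \<times> {0..T}) (\<lambda>z. u (f (fst z)) (snd z))"
      if "continuous_on UNIV f" for f :: "(real^'n) \<times> (real^'n) \<Rightarrow> real^'n"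
    proof -
      have "continuous_on (UNIV \<times> {0..T}) (\<lambda>z. case (f (fst z), snd z) of (x, t) \<Rightarrow> u x t)"
        by (rule continuous_on_compose2[OF u_cont])
           (auto intro!: continuous_intros continuous_on_compose2[OF that])
      then show ?thesis by simp
    qed
    have "continuous_on (UNIV \<times> {0..T}) (\<lambda>z::((real^'n) \<times> (real^'n)) \<times> real.
        case (norm (snd (fst z) - fst (fst z)) / 2, snd z) of (r, t) \<Rightarrow> \<phi> r t)"
      by (rule continuous_on_compose2[OF phi_cont]) (auto intro!: continuous_intros)
    then have phi1: "continuous_on (UNIV \<times> {0..T}) (\<lambda>z::((real^'n) \<times> (real^'n)) \<times> real.
        \<phi> (norm (snd (fst z) - fst (fst z)) / 2) (snd z))" by simp
    show ?thesis
      unfolding Z_def case_prod_beta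
      by (intro continuous_intros u1 phi1 continuous_on_compose2[OF Psi_cont]) auto
  qed

  \<comment> \<open>The maximum principle: compare all derivatives at the first touching point of \<open>Z\<close> with 0.\<close>
  have Z_neg: "Z \<epsilon> p T < 0" if eps: "\<epsilon> > 0" and T: "T \<ge> 0" for \<epsilon> T p
  proof (rule ccontr)
    assume "\<not> Z \<epsilon> p T < 0"
    then have Zp: "Z \<epsilon> p T \<ge> 0" by simp
    have "\<forall>\<^sub>F x in at_infinity. \<Psi> x > 2 / \<epsilon>"
      using Psi_infinity by (simp add: filterlim_at_top_dense)
    then obtain R where R: "\<And>x. norm x \<ge> R \<Longrightarrow> \<Psi> x > 2 / \<epsilon>"
      by (auto simp: eventually_at_infinity)
    have outside: "Z \<epsilon> p' t < 0" if "p' \<notin> cball 0 R \<times> cball 0 R" "0 \<le> t" for p' t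
    proof -
      have "norm (fst p') \<ge> R \<or> norm (snd p') \<ge> R"
        using that(1) by (cases p') auto
      then have "\<Psi> (fst p') + \<Psi> (snd p') > 2 / \<epsilon>"
        using R[of "fst p'"] R[of "snd p'"] Psi_pos[of "fst p'"] Psi_pos[of "snd p'"] by linarith
      then have *: "2 < \<epsilon> * (\<Psi> (fst p') + \<Psi> (snd p'))"
        using eps by (simp add: field_simps)
      also have "\<dots> \<le> exp (C * t) * (\<epsilon> * (\<Psi> (fst p') + \<Psi> (snd p')))"
        using mult_right_mono[of 1 "exp (C * t)" "\<epsilon> * (\<Psi> (fst p') + \<Psi> (snd p'))"] * C0 that(2) by simp
      finally have "2 < \<epsilon> * exp (C * t) * (\<Psi> (fst p') + \<Psi> (snd p'))"
        by (simp add: mult_ac)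
      moreover have "\<phi> (norm (snd p' - fst p') / 2) t \<ge> 0"
        using that(2) by (intro phi_nonneg) auto
      ultimately show ?thesis
        unfolding Z_def using u_le[OF that(2), of "fst p'"] u_le[OF that(2), of "snd p'"] by linarith
    qed
    have init: "Z \<epsilon> p' 0 < 0" for p'
    proof -
      have "\<bar>u (snd p') 0 - u (fst p') 0\<bar> \<le> 2 * \<phi> (norm (snd p' - fst p') / 2) 0"
        using phi_init unfolding modulus_of_continuity_def by blast
      moreover have "\<epsilon> * (\<Psi> (fst p') + \<Psi> (snd p')) > 0"
        using eps Psi_pos[of "fst p'"] Psi_pos[of "snd p'"] by simp
      ultimately show ?thesis by (simp add: Z_def)
    qed
    obtain p1 t where t: "0 < t" "t \<le> T" and Z0: "Z \<epsilon> p1 t = 0"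
      and Zmax: "\<And>p'. Z \<epsilon> p' t \<le> 0" and before: "\<And>s. 0 \<le> s \<Longrightarrow> s < t \<Longrightarrow> Z \<epsilon> p1 s < 0"
    proof (rule first_touching_time[of T "Z \<epsilon>" "cball 0 R \<times> cball 0 R" p])
      show "continuous_on (UNIV \<times> {0..T}) (\<lambda>(p, t). Z \<epsilon> p t)" by (rule Z_cont)
      show "compact (cball (0::real^'n) R \<times> cball (0::real^'n) R)"
        by (intro compact_Times compact_cball)
    qed (use outside init T Zp in auto)
    define x y where "x = fst p1" and "y = snd p1"
    define r e where "r = norm (y - x) / 2" and "e = sgn (y - x)"
    define m where "m = \<epsilon> * exp (C * t)"
    define w where "w = (\<lambda>z. m * \<Psi> z)"
    define v where "v = (\<lambda>z. u z t)"
    define g where "g = odd_ext (\<lambda>s. \<phi> s t)"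
    have m: "m > 0" using eps by (simp add: m_def)
    have touch: "v y - v x = 2 * \<phi> r t + w x + w y"
      using Z0 by (simp add: Z_def x_def y_def r_def m_def w_def v_def algebra_simps)
    have bound: "v b - v a \<le> 2 * \<phi> (norm (b - a) / 2) t + w a + w b" for a b
      using Zmax[of "(a, b)"] by (simp add: Z_def m_def w_def v_def algebra_simps)
    have xy: "x \<noteq> y"
    proof
      assume "x = y"
      then have "w x + w x = 0" using touch t(1) phi_0[of t] by (simp add: r_def)
      then show False using m Psi_pos[of x] by (simp add: w_def)
    qed
    have r: "r > 0" using xy by (simp add: r_def)
    have e: "norm e = 1" using xy by (simp add: e_def norm_sgn)

    have w_diff: "w differentiable (at z)" for z
      unfolding w_def using Psi_diff by (intro differentiable_mult) auto
    have grad_w: "grad w z = m *\<^sub>R grad \<Psi> z" for z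
    proof (rule grad_eqI)
      have "GDERIV (\<lambda>z. m * \<Psi> z) z :> m *\<^sub>R grad \<Psi> z + \<Psi> z *\<^sub>R 0"
        by (intro GDERIV_mult GDERIV_const GDERIV_grad Psi_diff)
      then show "GDERIV w z :> m *\<^sub>R grad \<Psi> z" by (simp add: w_def)
    qed
    have v_diff: "v differentiable (at z)" for z
      unfolding v_def by (rule u_diff[OF t(1)])
    have phi_r: "((\<lambda>s. \<phi> s t) has_real_derivative \<phi>' r t) (at r)"
      using r t(1) by (intro phi_deriv) auto
    \<comment> \<open>Both gradients are \<open>\<phi>' e\<close> up to terms of size \<open>\<epsilon>\<close>, so the nonlinearities at \<open>x\<close> and \<open>y\<close> nearly cancel.\<close>
    have grad_y: "grad v y = \<phi>' r t *\<^sub>R e + m *\<^sub>R grad \<Psi> y"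
      unfolding e_def grad_w[symmetric]
    proof (rule grad_at_touching_point[OF v_diff w_diff _ xy, where c = "v x + w x" and h = "\<lambda>s. \<phi> s t"])
      show "v z \<le> v x + w x + 2 * \<phi> (norm (z - x) / 2) t + w z" for z
        using bound[of z x] by simp
    qed (use phi_r touch in \<open>simp_all add: r_def\<close>)
    \<comment> \<open>As a function of its other argument, \<open>Z\<close> involves \<open>- v\<close>; hence the same lemma, applied to \<open>- v\<close>.\<close>
    have grad_x: "grad v x = \<phi>' r t *\<^sub>R e - m *\<^sub>R grad \<Psi> x"
    proof -
      have "grad (\<lambda>z. - v z) x = \<phi>' r t *\<^sub>R sgn (x - y) + grad w x"
      proof (rule grad_at_touching_point[OF _ w_diff _ xy[symmetric], where c = "- v y + w y" and h = "\<lambda>s. \<phi> s t"])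
        show "(\<lambda>z. - v z) differentiable (at x)"
          using v_diff by simp
        show "- v z \<le> - v y + w y + 2 * \<phi> (norm (z - y) / 2) t + w z" for z
          using bound[of y z] by (simp add: norm_minus_commute)
      qed (use phi_r touch in \<open>simp_all add: r_def norm_minus_commute\<close>)
      moreover have "grad (\<lambda>z. - v z) x = - grad v x"
        by (intro grad_eqI GDERIV_minus GDERIV_grad v_diff)
      moreover have "sgn (x - y) = - e"
        unfolding e_def by (metis minus_diff_eq sgn_minus)
      ultimately show ?thesis by (simp add: grad_w algebra_simps)
    qed
    have q_diff: "q (norm (grad v y)) - q (norm (grad v x)) \<le> c * KD * (w x + w y)"
    proof -
      have "q (norm (grad v y)) - q (norm (grad v x)) \<le> c * \<bar>norm (grad v y) - norm (grad v x)\<bar>"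
        using lipschitz_of_deriv_bound[OF q_deriv q'_bound, of "norm (grad v y)" "norm (grad v x)"] by simp
      also have "\<dots> \<le> c * norm (grad v y - grad v x)"
        using c_pos by (intro mult_left_mono norm_triangle_ineq3) auto
      also have "grad v y - grad v x = m *\<^sub>R (grad \<Psi> y + grad \<Psi> x)"
        by (simp add: grad_x grad_y algebra_simps)
      also have "c * norm (m *\<^sub>R (grad \<Psi> y + grad \<Psi> x)) \<le> c * (m * (KD * \<Psi> y + KD * \<Psi> x))"
      proof (intro mult_left_mono)
        have "norm (grad \<Psi> y + grad \<Psi> x) \<le> KD * \<Psi> y + KD * \<Psi> x"
          using norm_triangle_ineq[of "grad \<Psi> y" "grad \<Psi> x"] grad_Psi[of x] grad_Psi[of y] by linarith
        then show "norm (m *\<^sub>R (grad \<Psi> y + grad \<Psi> x)) \<le> m * (KD * \<Psi> y + KD * \<Psi> x)"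
          using m by simp
      qed (use c_pos in simp)
      also have "\<dots> = c * KD * (w x + w y)" by (simp add: w_def algebra_simps)
      finally show ?thesis .
    qed

    have g_pos: "g s = \<phi> s t" if "s \<ge> 0" for s
      using that by (simp add: g_def odd_ext_def)
    have g_meas [measurable]: "g \<in> borel_measurable borel"
      unfolding g_def using t(1) by (intro borel_measurable_odd_ext phi_time_cont) auto
    have odd: "g (- s) = - g s" for s
      using phi_0[of t] t(1) by (auto simp: g_def odd_ext_def)
    have h_meas: "(\<lambda>s. g (r + s) - g r) \<in> borel_measurable borel" by measurable
    have g_int: "integrable lborel (\<lambda>z. \<rho> z * (g (r + z \<bullet> e) - g r))"
      using phi_L_conv[OF t(1), of r, folded g_def]
        radial_integral_direction(1)[OF rho_L1 rho_nonneg rho_radial h_meas e, where k = k]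
      by (simp add: nonlocal1_integrand_def[abs_def])
    have g_op: "(\<integral>z. \<rho> z * (g (r + z \<bullet> e) - g r) \<partial>lborel) = nonlocal1_op (reduced_kernel k \<rho>) g r"
      unfolding nonlocal1_op_def nonlocal1_integrand_def
      by (rule radial_integral_direction(2)[OF rho_L1 rho_nonneg rho_radial h_meas e, symmetric])
    have v_meas: "v \<in> borel_measurable borel"
      unfolding v_def using t(1) by (intro borel_measurable_continuous_onI u_time_cont) auto
    have w_meas: "w \<in> borel_measurable borel"
      unfolding w_def by (intro borel_measurable_continuous_onI continuous_intros Psi_cont)
    have L_diff: "nonlocal_op \<rho> v y - nonlocal_op \<rho> v x
        \<le> 2 * nonlocal1_op (reduced_kernel k \<rho>) g r + nonlocal_op \<rho> w x + nonlocal_op \<rho> w y"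
      unfolding g_op[symmetric]
    proof (rule nonlocal_op_reflection_coupling[where \<rho> = \<rho> and g = g,
          OF _ rho_nonneg rho_radial rho_nonincreasing v_meas w_meas _ odd xy r_def])
      show "e = (y - x) /\<^sub>R norm (y - x)" by (simp add: e_def sgn_div_norm)
      show "w z \<ge> 0" for z using m Psi_pos[of z] by (simp add: w_def)
      show "integrable lborel (nonlocal_integrand \<rho> v x)" "integrable lborel (nonlocal_integrand \<rho> v y)"
        unfolding v_def using u_L_conv[OF t(1)] by auto
      show "integrable lborel (nonlocal_integrand \<rho> w x)" "integrable lborel (nonlocal_integrand \<rho> w y)"
        unfolding w_def nonlocal_integrand_cmult using Psi_L_conv by auto
      show "v b - v a \<le> 2 * g (norm (b - a) / 2) + w a + w b" for a b
        using bound[of b a] by (simp add: g_pos)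
      show "v y - v x = 2 * g r + w x + w y"
        using touch r by (simp add: g_pos)
    qed (use g_int in simp_all)
    \<comment> \<open>Here \<open>\<Psi> \<ge> 1\<close> and \<open>K \<ge> 0\<close> turn the constant bound on \<open>L \<Psi>\<close> into a multiple of \<open>w\<close>.\<close>
    have L_w: "nonlocal_op \<rho> w z \<le> KL * w z" for z
    proof -
      have "nonlocal_op \<rho> w z \<le> m * KL"
        unfolding w_def nonlocal_op_cmult using m L_Psi[of z] by simp
      also have "\<dots> \<le> m * KL * \<Psi> z"
        using mult_left_mono[OF Psi_ge_1[of z], of "m * KL"] m KL0 by simp
      finally show ?thesis by (simp add: w_def mult_ac)
    qed

    have "((\<lambda>\<tau>. odd_ext (\<lambda>s. \<phi> s \<tau>) r) has_real_derivative nonlocal1_op (reduced_kernel k \<rho>) g r) (at t)"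
      unfolding g_def by (rule phi_eq[OF t(1)])
    then have phi_t: "((\<lambda>\<tau>. \<phi> r \<tau>) has_real_derivative nonlocal1_op (reduced_kernel k \<rho>) g r) (at t)"
      using r by (simp add: odd_ext_def)
    have "((\<lambda>s. u y s - u x s - 2 * \<phi> r s - \<epsilon> * exp (C * s) * (\<Psi> x + \<Psi> y)) has_real_derivative
        (nonlocal_op \<rho> v y + q (norm (grad v y))) - (nonlocal_op \<rho> v x + q (norm (grad v x)))
        - 2 * nonlocal1_op (reduced_kernel k \<rho>) g r - C * (w x + w y)) (at t)"
      unfolding v_def
      by (rule derivative_eq_intros u_eq[OF t(1)] phi_t refl)+ (simp add: w_def m_def algebra_simps)
    then have "(Z \<epsilon> p1 has_real_derivative
        (nonlocal_op \<rho> v y + q (norm (grad v y))) - (nonlocal_op \<rho> v x + q (norm (grad v x)))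
        - 2 * nonlocal1_op (reduced_kernel k \<rho>) g r - C * (w x + w y)) (at t)"
      by (simp add: Z_def[abs_def] x_def y_def r_def)
    from DERIV_nonneg_at_left_max[OF this t(1)] before Z0
    have "0 \<le> (nonlocal_op \<rho> v y + q (norm (grad v y))) - (nonlocal_op \<rho> v x + q (norm (grad v x)))
        - 2 * nonlocal1_op (reduced_kernel k \<rho>) g r - C * (w x + w y)"
      by (simp add: less_imp_le)
    \<comment> \<open>The reduced operator applied to \<open>\<phi>\<close> cancels against the time derivative of \<open>\<phi>\<close>; the summand 1
        in \<open>C\<close> makes the rest a contradiction.\<close>
    then have "C * (w x + w y) \<le> KL * (w x + w y) + c * KD * (w x + w y)"
      using L_diff q_diff L_w[of x] L_w[of y] by (simp add: algebra_simps)
    then have "w x + w y \<le> 0" by (simp add: C_def algebra_simps)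
    moreover have "w x > 0" "w y > 0" using m Psi_pos by (simp_all add: w_def)
    ultimately show False by linarith
  qed

  have main: "u y t - u x t \<le> 2 * \<phi> (norm (y - x) / 2) t" if t: "t \<ge> 0" for x y t
  proof (rule field_le_epsilon)
    fix \<delta> :: real assume \<delta>: "\<delta> > 0"
    define M where "M = exp (C * t) * (\<Psi> x + \<Psi> y)"
    have M: "M > 0" using Psi_pos[of x] Psi_pos[of y] by (simp add: M_def add_pos_pos)
    have "Z (\<delta> / M) (x, y) t < 0" using \<delta> M t by (intro Z_neg) auto
    moreover have "\<delta> / M * exp (C * t) * (\<Psi> x + \<Psi> y) = \<delta>"
      using M by (simp add: M_def field_simps)
    ultimately show "u y t - u x t \<le> 2 * \<phi> (norm (y - x) / 2) t + \<delta>"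
      by (simp add: Z_def)
  qed
  show ?thesis
    unfolding modulus_of_continuity_def
  proof (intro allI impI conjI)
    fix t :: real assume t: "t \<ge> 0"
    show "\<phi> s t \<ge> 0" if "s \<ge> 0" for s using that t by (rule phi_nonneg)
    show "continuous (at 0 within {0..}) (\<lambda>r. \<phi> r t)"
      using phi_time_cont[OF t] by (simp add: continuous_on_eq_continuous_within)
    show "\<phi> 0 t = 0" using t by (rule phi_0)
    show "\<bar>u y t - u x t\<bar> \<le> 2 * \<phi> (norm (y - x) / 2) t" for x y
      using main[OF t, of y x] main[OF t, of x y] by (simp add: abs_le_iff norm_minus_commute)
  qed
qed

end
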